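(* Consider the multinomial choice model described in the context. Suppose: (1) The function $p_0(x)=\Pr(\mathbf y=0\mid \mathbf x=x)$ is known (identified) for all $x\in X$. (2) For all $w\in W$: (i) $\boldsymbol\varepsilon$ is conditionally independent of $(\mathbf e,\mathbf d,\mathbf z)$ conditional on $\mathbf w=w$; (ii) $\mathbf e$ is conditionally independent of $(\mathbf d,\mathbf z)$ conditional on $\mathbf w=w$. (3) For all $w\in W$: (i) conditional on $\mathbf w=w$, $\mathbf e$ has mean zero and variance one; (ii) for some $\bar y\in Y\setminus\{0\}$, the conditional c.d.f. $F_{\boldsymbol\varepsilon|\mathbf w}(\cdot|w)$ has bounded partial derivatives with respect to its component $\varepsilon_{\bar y}$ up to order $\kappa$, and $\partial^l_{\varepsilon_{\bar y}^l}F_{\boldsymbol\varepsilon|\mathbf w}(\varepsilon|w)\big|_{\varepsilon=0}\neq 0$ for all $l\le\kappa$; (iii) there exists $d^*$ such that the support of $(\mathbf d,\mathbf z)$ conditional on $\mathbf w=w$ contains the point $(d^*,0)$ together with an open neighborhood of it. Then $\beta_0(w)$, $\beta_1(w)$ and $\mathbb E[\mathbf e^l\mid\mathbf w=w]$, $0\le l\le\kappa$, are identified for all $w\in W$.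
   Context: Model. An agent chooses $\mathbf y\in Y=\{0,1,\dots,J\}$ to maximize utility. The utility of $y=0$ is normalized to $0$; the utility of $y\ne0$ is $$\mathbf z_y\big[\beta_0(\mathbf w)+\beta_1(\mathbf w)\mathbf d+\mathbf e\big]+\boldsymbol\varepsilon_y .$$ Here $\mathbf z=(\mathbf z_y)_{y\ne0}\in\mathbb R^J$, $\mathbf d\in\mathbb R$ and $\mathbf w\in W\subseteq\mathbb R^{d_w}$ are observed covariates; $\mathbf x=(\mathbf d,\mathbf z,\mathbf w)$ has support $X$; $\mathbf e\in\mathbb R$ and $\boldsymbol\varepsilon=(\boldsymbol\varepsilon_y)_{y\neq0}\in\mathbb R^J$ are latent random variables; $\beta_0,\beta_1:W\to\mathbb R$ are unknown functions with $\beta_1(w)\ne0$ for all $w\in W$. $F_{\boldsymbol\varepsilon|\mathbf w}(\cdot|w)$ is the c.d.f. of $\boldsymbol\varepsilon$ conditional on $\mathbf w=w$. Ties with the outside option are resolved in favor of $0$, so that, under the conditional independence assumptions in the claim, $$p_0(d,z,w)=\int F_{\boldsymbol\varepsilon|\mathbf w}\big(-z_1(\beta_0(w)+\beta_1(w)d+e),\dots,-z_J(\beta_0(w)+\beta_1(w)d+e)\,\big|\,w\big)\,dF_{\mathbf e|\mathbf w}(e|w).$$ $\kappa\le\infty$ denotes an order of differentiability (possibly infinite). Identification. A feature of the model (a function of the structure $(\beta_0,\beta_1,F_{\mathbf e|\mathbf w},F_{\boldsymbol\varepsilon|\mathbf w})$) is identified if any two structures satisfying all the stated assumptions and generating the same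 function $p_0$ on $X$ have the same value of that feature.
   Formalization: The formal statement assumes κ ≥ 2, since for κ ≤ 1 the coefficients β₀, β₁ need not be identified, and identifies E[e^l | w = w] among structures for which this l-th moment exists (automatic for l ≤ 2). *)

theory Defs
  imports "HOL-Probability.Probability" "HOL-Library.Extended_Nat"
begin

text \<open>
  The nonzero alternatives $1,\dots,J$ are the elements of a finite type \<open>'j\<close> and
  $Y$ is \<open>'j option\<close>, with \<open>None\<close> the outside option $y = 0$.
  A structure consists of \<open>\<beta>\<^sub>0\<close>, \<open>\<beta>\<^sub>1\<close> and, for every \<open>w\<close>, the joint law of
  \<open>(d, z, e, \<epsilon>)\<close> conditional on \<open>w\<close>; the conditional distributions of \<open>e\<close> and \<open>\<epsilon>\<close>
  are its marginals.
\<close>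

type_synonym ('j) outcome = "real \<times> (real^'j) \<times> real \<times> (real^'j)"

record ('j, 'k) model =
  beta0 :: "real^'k \<Rightarrow> real"
  beta1 :: "real^'k \<Rightarrow> real"
  law :: "real^'k \<Rightarrow> ('j outcome) measure"

definition rv_dz :: "'j::finite outcome \<Rightarrow> real \<times> (real^'j)" where
  "rv_dz = (\<lambda>(d, z, e, \<epsilon>). (d, z))"

definition rv_e :: "'j::finite outcome \<Rightarrow> real" where
  "rv_e = (\<lambda>(d, z, e, \<epsilon>). e)"

definition rv_eps :: "'j::finite outcome \<Rightarrow> real^'j" where
  "rv_eps = (\<lambda>(d, z, e, \<epsilon>). \<epsilon>)"

definition e_law :: "('j::finite, 'k::finite) model \<Rightarrow> real^'k \<Rightarrow> real measure" where
  "e_law s w = distr (law s w) borel rv_e"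

definition eps_law :: "('j::finite, 'k::finite) model \<Rightarrow> real^'k \<Rightarrow> (real^'j) measure" where
  "eps_law s w = distr (law s w) borel rv_eps"

definition joint_cdf :: "(real^'j::finite) measure \<Rightarrow> real^'j \<Rightarrow> real" where
  "joint_cdf M x = measure M {v. \<forall>y. v $ y \<le> x $ y}"

fun utility :: "('j::finite, 'k::finite) model \<Rightarrow> real^'k \<Rightarrow> 'j outcome \<Rightarrow> 'j option \<Rightarrow> real" where
  "utility s w (d, z, e, \<epsilon>) None = 0"
| "utility s w (d, z, e, \<epsilon>) (Some y) = z $ y * (beta0 s w + beta1 s w * d + e) + \<epsilon> $ y"

text \<open>Ties are resolved in favor of the outside option.\<close>

definition chooses_outside :: "('j::finite, 'k::finite) model \<Rightarrow> real^'k \<Rightarrow> 'j outcome \<Rightarrow> bool" where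
  "chooses_outside s w \<omega> \<longleftrightarrow> (\<forall>y. utility s w \<omega> y \<le> utility s w \<omega> None)"

text \<open>
  The version of $\Pr(y = 0 \mid x)$ given by the integral formula of the model; see
  \<open>p0_conditional_probability\<close> below.
\<close>

definition p0 :: "('j::finite, 'k::finite) model \<Rightarrow> real \<times> (real^'j) \<times> (real^'k) \<Rightarrow> real" where
  "p0 s = (\<lambda>(d, z, w). \<integral>e. joint_cdf (eps_law s w)
     (\<chi> y. - (z $ y) * (beta0 s w + beta1 s w * d + e)) \<partial>(e_law s w))"

definition measure_support :: "'a::topological_space measure \<Rightarrow> 'a set" where
  "measure_support M = {x. \<forall>U. open U \<and> x \<in> U \<longrightarrow> emeasure M U > 0}"

text \<open>
  \<open>Q w\<close> is the law of \<open>(d, z)\<close> conditional on \<open>w\<close>. It belongs to the observed data and is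
  shared by all structures under comparison.
\<close>

definition covariate_support ::
    "(real^'k) set \<Rightarrow> (real^'k \<Rightarrow> (real \<times> (real^'j)) measure) \<Rightarrow>
     (real \<times> (real^'j::finite) \<times> (real^'k::finite)) set" where
  "covariate_support W Q = {(d, z, w). w \<in> W \<and> (d, z) \<in> measure_support (Q w)}"

definition model_on ::
    "(real^'k) set \<Rightarrow> (real^'k \<Rightarrow> (real \<times> (real^'j)) measure) \<Rightarrow>
     ('j::finite, 'k::finite) model \<Rightarrow> bool" where
  "model_on W Q s \<longleftrightarrow> (\<forall>w\<in>W. beta1 s w \<noteq> 0 \<and> prob_space (law s w) \<and> sets (law s w) = sets borel \<and>
     distr (law s w) borel rv_dz = Q w)"

text \<open>
  The library's \<open>indep_var\<close> forces both variables to have values in the same type; this is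
  its characterization \<open>indep_var_eq\<close> without that restriction.
\<close>

definition indep_rvs ::
    "'o measure \<Rightarrow> ('o \<Rightarrow> 'a::topological_space) \<Rightarrow> ('o \<Rightarrow> 'b::topological_space) \<Rightarrow> bool" where
  "indep_rvs M X Y \<longleftrightarrow> X \<in> borel_measurable M \<and> Y \<in> borel_measurable M \<and>
     prob_space.indep_set M {X -` A \<inter> space M | A. A \<in> sets borel} {Y -` B \<inter> space M | B. B \<in> sets borel}"

definition latent_independence ::
    "(real^'k) set \<Rightarrow> ('j::finite, 'k::finite) model \<Rightarrow> bool" where
  "latent_independence W s \<longleftrightarrow> (\<forall>w\<in>W.
     indep_rvs (law s w) rv_eps (\<lambda>\<omega>. (rv_e \<omega>, rv_dz \<omega>)) \<and>
     indep_rvs (law s w) rv_e rv_dz)"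

definition normalized :: "(real^'k) set \<Rightarrow> ('j::finite, 'k::finite) model \<Rightarrow> bool" where
  "normalized W s \<longleftrightarrow> (\<forall>w\<in>W.
     integrable (law s w) rv_e \<and> integrable (law s w) (\<lambda>\<omega>. (rv_e \<omega>)\<^sup>2) \<and>
     prob_space.expectation (law s w) rv_e = 0 \<and> prob_space.variance (law s w) rv_e = 1)"

text \<open>\<open>along i f x\<close> is \<open>f\<close> on the line through \<open>x\<close> in coordinate direction \<open>i\<close>.\<close>

definition along :: "'j::finite \<Rightarrow> (real^'j \<Rightarrow> real) \<Rightarrow> real^'j \<Rightarrow> real \<Rightarrow> real" where
  "along i f x = (\<lambda>t. f (x + t *\<^sub>R axis i 1))"

definition partial_deriv :: "'j::finite \<Rightarrow> (real^'j \<Rightarrow> real) \<Rightarrow> real^'j \<Rightarrow> real" where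
  "partial_deriv i f x = deriv (along i f x) 0"

definition bounded_partials :: "enat \<Rightarrow> 'j::finite \<Rightarrow> (real^'j \<Rightarrow> real) \<Rightarrow> bool" where
  "bounded_partials \<kappa> i f \<longleftrightarrow>
     (\<forall>l. enat l < \<kappa> \<longrightarrow> (\<forall>x. along i ((partial_deriv i ^^ l) f) x differentiable at 0)) \<and>
     (\<forall>l. enat l \<le> \<kappa> \<longrightarrow> bounded (range ((partial_deriv i ^^ l) f)))"

text \<open>The alternative \<open>y\<close> may depend on \<open>w\<close> and on the structure.\<close>

definition smooth_eps ::
    "enat \<Rightarrow> (real^'k) set \<Rightarrow> ('j::finite, 'k::finite) model \<Rightarrow> bool" where
  "smooth_eps \<kappa> W s \<longleftrightarrow> (\<forall>w\<in>W. \<exists>y. bounded_partials \<kappa> y (joint_cdf (eps_law s w)) \<and>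
     (\<forall>l. enat l \<le> \<kappa> \<longrightarrow> (partial_deriv y ^^ l) (joint_cdf (eps_law s w)) 0 \<noteq> 0))"

definition support_condition ::
    "(real^'k) set \<Rightarrow> (real^'k \<Rightarrow> (real \<times> (real^'j::finite)) measure) \<Rightarrow> bool" where
  "support_condition W Q \<longleftrightarrow>
     (\<forall>w\<in>W. \<exists>d U. open U \<and> (d, 0) \<in> U \<and> U \<subseteq> measure_support (Q w))"

definition admissible ::
    "enat \<Rightarrow> (real^'k) set \<Rightarrow> (real^'k \<Rightarrow> (real \<times> (real^'j)) measure) \<Rightarrow>
     ('j::finite, 'k::finite) model \<Rightarrow> bool" where
  "admissible \<kappa> W Q s \<longleftrightarrow>
     model_on W Q s \<and> latent_independence W s \<and> normalized W s \<and> smooth_eps \<kappa> W s"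

definition moment :: "('j::finite, 'k::finite) model \<Rightarrow> nat \<Rightarrow> real^'k \<Rightarrow> real" where
  "moment s l w = prob_space.expectation (law s w) (\<lambda>\<omega>. (rv_e \<omega>) ^ l)"

text \<open>
  The integral of a non-integrable function is \<open>0\<close> by convention, so statements about
  \<open>moment\<close> are meaningful only where \<open>moment_exists\<close> holds.
\<close>

definition moment_exists :: "('j::finite, 'k::finite) model \<Rightarrow> nat \<Rightarrow> real^'k \<Rightarrow> bool" where
  "moment_exists s l w \<longleftrightarrow> integrable (law s w) (\<lambda>\<omega>. (rv_e \<omega>) ^ l)"

definition identified_from :: "('s \<Rightarrow> 'o) \<Rightarrow> ('s \<Rightarrow> bool) \<Rightarrow> ('s \<Rightarrow> 'f) \<Rightarrow> bool" where
  "identified_from observable assumptions feature \<longleftrightarrow>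
     (\<forall>s s'. assumptions s \<and> assumptions s' \<and> observable s = observable s'
        \<longrightarrow> feature s = feature s')"

lemma measurable_rvs [measurable]:
  "(rv_dz :: 'j::finite outcome \<Rightarrow> _) \<in> borel_measurable borel"
  "(rv_e :: 'j outcome \<Rightarrow> _) \<in> borel_measurable borel"
  "(rv_eps :: 'j outcome \<Rightarrow> _) \<in> borel_measurable borel"
proof -
  have *: "rv_dz = (\<lambda>\<omega>::'j outcome. (fst \<omega>, fst (snd \<omega>)))"
    "rv_e = (\<lambda>\<omega>::'j outcome. fst (snd (snd \<omega>)))"
    "rv_eps = (\<lambda>\<omega>::'j outcome. snd (snd (snd \<omega>)))"
    by (auto simp: rv_dz_def rv_e_def rv_eps_def)
  show "(rv_dz :: 'j outcome \<Rightarrow> _) \<in> borel_measurable borel"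
    unfolding * by (intro borel_measurable_continuous_onI continuous_intros)
  show "(rv_e :: 'j outcome \<Rightarrow> _) \<in> borel_measurable borel"
    unfolding * by (intro borel_measurable_continuous_onI continuous_intros)
  show "(rv_eps :: 'j outcome \<Rightarrow> _) \<in> borel_measurable borel"
    unfolding * by (intro borel_measurable_continuous_onI continuous_intros)
qed

lemma indep_rvs_distr:
  fixes X :: "'o \<Rightarrow> 'a::second_countable_topology" and Y :: "'o \<Rightarrow> 'b::second_countable_topology"
  assumes "prob_space M" "indep_rvs M X Y"
  shows "distr M borel (\<lambda>\<omega>. (X \<omega>, Y \<omega>)) = distr M borel X \<Otimes>\<^sub>M distr M borel Y"
proof -
  interpret prob_space M by fact
  have [measurable]: "X \<in> borel_measurable M" "Y \<in> borel_measurable M"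
    using assms by (auto simp: indep_rvs_def)
  interpret PX: prob_space "distr M borel X" by (rule prob_space_distr) simp
  interpret PY: prob_space "distr M borel Y" by (rule prob_space_distr) simp
  have "distr M borel X \<Otimes>\<^sub>M distr M borel Y = distr M borel (\<lambda>\<omega>. (X \<omega>, Y \<omega>))"
  proof (rule pair_measure_eqI)
    show "sigma_finite_measure (distr M borel X)" "sigma_finite_measure (distr M borel Y)"
      by unfold_locales
    show "sets (distr M borel X \<Otimes>\<^sub>M distr M borel Y) = sets (distr M borel (\<lambda>\<omega>. (X \<omega>, Y \<omega>)))"
      by (simp flip: borel_prod cong: sets_pair_measure_cong)
    fix A B assume "A \<in> sets (distr M borel X)" "B \<in> sets (distr M borel Y)"
    then have [measurable]: "A \<in> sets borel" "B \<in> sets borel" by auto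
    have AB: "A \<times> B \<in> sets borel" unfolding borel_prod[symmetric] by measurable
    have "prob ((X -` A \<inter> space M) \<inter> (Y -` B \<inter> space M)) =
        prob (X -` A \<inter> space M) * prob (Y -` B \<inter> space M)"
      using assms(2) \<open>A \<in> sets borel\<close> \<open>B \<in> sets borel\<close> unfolding indep_rvs_def
      by (intro indep_setD) auto
    moreover have "(\<lambda>\<omega>. (X \<omega>, Y \<omega>)) -` (A \<times> B) \<inter> space M =
        (X -` A \<inter> space M) \<inter> (Y -` B \<inter> space M)" by auto
    ultimately show "emeasure (distr M borel X) A * emeasure (distr M borel Y) B =
        emeasure (distr M borel (\<lambda>\<omega>. (X \<omega>, Y \<omega>))) (A \<times> B)"
      using AB by (simp add: emeasure_distr emeasure_eq_measure ennreal_mult)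
  qed
  then show ?thesis by simp
qed

text \<open>\<open>p0\<close> is a version of the probability of \<open>y = 0\<close> conditional on \<open>(d, z)\<close> given \<open>w\<close>.\<close>

lemma p0_conditional_probability:
  fixes s :: "('j::finite, 'k::finite) model"
  assumes "model_on W Q s" "latent_independence W s" "w \<in> W" and A: "A \<in> sets borel"
  shows "measure (law s w) {\<omega>. rv_dz \<omega> \<in> A \<and> chooses_outside s w \<omega>} =
    (\<integral>x. indicator A x * p0 s (fst x, snd x, w) \<partial>Q w)"
proof -
  let ?L = "law s w"
  let ?b = "\<lambda>d. beta0 s w + beta1 s w * d"
  from assms have P: "prob_space ?L" and S[measurable_cong]: "sets ?L = sets borel"
    and Q: "distr ?L borel rv_dz = Q w" by (auto simp: model_on_def)
  have i1: "indep_rvs ?L rv_eps (\<lambda>\<omega>. (rv_e \<omega>, rv_dz \<omega>))" and i2: "indep_rvs ?L rv_e rv_dz"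
    using assms by (auto simp: latent_independence_def)
  interpret prob_space ?L by fact
  have sp: "space ?L = UNIV" using sets_eq_imp_space_eq[OF S] by simp
  have [measurable]: "rv_eps \<in> borel_measurable ?L" "rv_e \<in> borel_measurable ?L"
    "rv_dz \<in> borel_measurable ?L" "(\<lambda>\<omega>. (rv_e \<omega>, rv_dz \<omega>)) \<in> borel_measurable ?L"
    using i1 i2 by (auto simp: indep_rvs_def)
  interpret E: prob_space "eps_law s w" unfolding eps_law_def by (rule prob_space_distr) simp
  interpret F: prob_space "e_law s w" unfolding e_law_def by (rule prob_space_distr) simp
  interpret G: prob_space "Q w" unfolding Q[symmetric] by (rule prob_space_distr) simp
  have sE[measurable_cong]: "sets (eps_law s w) = sets borel" by (simp add: eps_law_def)
  have sF[measurable_cong]: "sets (e_law s w) = sets borel" by (simp add: e_law_def)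
  have sG[measurable_cong]: "sets (Q w) = sets borel" unfolding Q[symmetric] by simp
  interpret FG: pair_prob_space "e_law s w" "Q w" ..
  interpret EFG: pair_prob_space "eps_law s w" "e_law s w \<Otimes>\<^sub>M Q w" ..
  have D: "distr ?L borel (\<lambda>\<omega>. (rv_eps \<omega>, rv_e \<omega>, rv_dz \<omega>)) =
      eps_law s w \<Otimes>\<^sub>M (e_law s w \<Otimes>\<^sub>M Q w)"
    using indep_rvs_distr[OF P i1] indep_rvs_distr[OF P i2]
    by (simp add: eps_law_def e_law_def Q)
  let ?B = "{(v :: real^'j, e :: real, x :: real \<times> (real^'j)). x \<in> A \<and>
      (\<forall>y. v $ y \<le> - (snd x $ y) * (?b (fst x) + e))}"
  have Beq: "?B = (\<lambda>p. snd (snd p)) -` A \<inter>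
      (\<Inter>y. {p. fst p $ y \<le> - (snd (snd (snd p)) $ y) * (?b (fst (snd (snd p))) + fst (snd p))})"
    by auto
  have "(\<lambda>p :: (real^'j) \<times> real \<times> real \<times> (real^'j). snd (snd p)) \<in> borel_measurable borel"
    by (intro borel_measurable_continuous_onI continuous_intros)
  from measurable_sets[OF this A]
  have m1: "(\<lambda>p :: (real^'j) \<times> real \<times> real \<times> (real^'j). snd (snd p)) -` A \<in> sets borel" by simp
  have m2: "closed (\<Inter>y. {p :: (real^'j) \<times> real \<times> real \<times> (real^'j).
      fst p $ y \<le> - (snd (snd (snd p)) $ y) * (?b (fst (snd (snd p))) + fst (snd p))})"
    by (intro closed_INT ballI closed_Collect_le continuous_intros)
  have B: "?B \<in> sets borel" unfolding Beq using m1 borel_closed[OF m2] by (rule sets.Int)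
  have B': "?B \<in> sets (eps_law s w \<Otimes>\<^sub>M (e_law s w \<Otimes>\<^sub>M Q w))"
    using B unfolding D[symmetric] by simp
  have ev: "chooses_outside s w \<omega> \<longleftrightarrow> (\<forall>y. rv_eps \<omega> $ y \<le>
      - (snd (rv_dz \<omega>) $ y) * (?b (fst (rv_dz \<omega>)) + rv_e \<omega>))" for \<omega>
  proof (cases \<omega>)
    case (fields d z e v)
    have "(\<forall>y. utility s w \<omega> y \<le> utility s w \<omega> None) \<longleftrightarrow>
        (\<forall>y. utility s w \<omega> (Some y) \<le> utility s w \<omega> None)"
      using fields by (metis option.exhaust order_refl)
    also have "\<dots> \<longleftrightarrow> (\<forall>y. v $ y \<le> - (z $ y) * (?b d + e))"
      using fields by (auto simp: algebra_simps) (smt (verit, best))+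
    finally show ?thesis using fields
      by (simp add: chooses_outside_def rv_dz_def rv_e_def rv_eps_def)
  qed
  have eq: "{\<omega>. rv_dz \<omega> \<in> A \<and> chooses_outside s w \<omega>} =
      (\<lambda>\<omega>. (rv_eps \<omega>, rv_e \<omega>, rv_dz \<omega>)) -` ?B \<inter> space ?L"
    by (auto simp: ev sp)
  have mm: "(\<lambda>\<omega>. (rv_eps \<omega>, rv_e \<omega>, rv_dz \<omega>)) \<in> borel_measurable ?L"
    by (intro borel_measurable_Pair) auto
  have "emeasure ?L {\<omega>. rv_dz \<omega> \<in> A \<and> chooses_outside s w \<omega>} =
      emeasure (eps_law s w \<Otimes>\<^sub>M (e_law s w \<Otimes>\<^sub>M Q w)) ?B"
    unfolding D[symmetric] eq using B mm by (simp add: emeasure_distr)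
  also have "\<dots> = (\<integral>\<^sup>+q. emeasure (eps_law s w) ((\<lambda>v. (v, q)) -` ?B) \<partial>(e_law s w \<Otimes>\<^sub>M Q w))"
    by (rule EFG.emeasure_pair_measure_alt2[OF B'])
  also have "\<dots> = (\<integral>\<^sup>+x. \<integral>\<^sup>+e. emeasure (eps_law s w) ((\<lambda>v. (v, e, x)) -` ?B) \<partial>e_law s w \<partial>Q w)"
    by (rule FG.nn_integral_snd[symmetric]) (use EFG.measurable_emeasure_Pair2[OF B'] in simp)
  finally have main: "emeasure ?L {\<omega>. rv_dz \<omega> \<in> A \<and> chooses_outside s w \<omega>} =
      (\<integral>\<^sup>+x. \<integral>\<^sup>+e. emeasure (eps_law s w) ((\<lambda>v. (v, e, x)) -` ?B) \<partial>e_law s w \<partial>Q w)" .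
  have pw: "(\<integral>\<^sup>+e. emeasure (eps_law s w) ((\<lambda>v. (v, e, x)) -` ?B) \<partial>e_law s w) =
        ennreal (indicator A x * p0 s (fst x, snd x, w))" for x
  proof -
    let ?f = "\<lambda>e. measure (eps_law s w) ((\<lambda>v. (v, e, x)) -` ?B)"
    have "x \<in> space (Q w)" using sets_eq_imp_space_eq[OF sG] by simp
    from measurable_compose[OF measurable_Pair2'[OF this] EFG.measurable_emeasure_Pair2[OF B']]
    have "(\<lambda>e. emeasure (eps_law s w) ((\<lambda>v. (v, e, x)) -` ?B)) \<in> borel_measurable (e_law s w)"
      .
    then have "?f \<in> borel_measurable (e_law s w)"
      unfolding measure_def by measurable
    then have I: "integrable (e_law s w) ?f"
      by (intro F.integrable_const_bound[of _ 1]) auto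
    have "(\<integral>\<^sup>+e. emeasure (eps_law s w) ((\<lambda>v. (v, e, x)) -` ?B) \<partial>e_law s w) = ennreal (\<integral>e. ?f e \<partial>e_law s w)"
      using nn_integral_eq_integral[OF I] by (simp add: E.emeasure_eq_measure)
    also have "(\<integral>e. ?f e \<partial>e_law s w) = indicator A x * p0 s (fst x, snd x, w)"
      by (cases "x \<in> A") (auto simp: p0_def joint_cdf_def vimage_def)
    finally show ?thesis .
  qed
  have nonneg: "0 \<le> indicator A x * p0 s (fst x, snd x, w)" for x
    by (auto simp: p0_def joint_cdf_def intro!: mult_nonneg_nonneg integral_nonneg_AE)
  have "(\<lambda>x. \<integral>\<^sup>+e. emeasure (eps_law s w) ((\<lambda>v. (v, e, x)) -` ?B) \<partial>e_law s w) \<in> borel_measurable (Q w)"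
    using measurable_compose[OF measurable_pair_swap' EFG.measurable_emeasure_Pair2[OF B']]
    by (intro F.borel_measurable_nn_integral) (simp add: case_prod_beta')
  from borel_measurable_enn2real[OF this]
  have "(\<lambda>x. indicator A x * p0 s (fst x, snd x, w)) \<in> borel_measurable (Q w)"
    unfolding pw using nonneg by simp
  then have "(\<integral>x. indicator A x * p0 s (fst x, snd x, w) \<partial>Q w) =
      enn2real (\<integral>\<^sup>+x. ennreal (indicator A x * p0 s (fst x, snd x, w)) \<partial>Q w)"
    using nonneg by (intro integral_eq_nn_integral) auto
  then show ?thesis using main unfolding pw by (simp add: measure_def)
qed

end

theory Submission
  imports Defs "HOL-Computational_Algebra.Polynomial"
begin

text \<open>
  Fix \<open>w\<close>, move \<open>z\<close> along the axis in which the first structure is smooth, and write \<open>b d\<close>, \<open>b' d\<close>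
  for the two indices \<open>\<beta>\<^sub>0 + \<beta>\<^sub>1 d\<close>. Observational equivalence says
  \<open>E g (t (b d + e)) = E' h (t (b' d + e')) =: \<phi>\<^sub>d t\<close> for small \<open>t\<close>, with \<open>g\<close> smooth at \<open>0\<close>; the
  second structure may be smooth along another axis only, so \<open>h\<close> is merely monotone.
  By Fubini, \<open>E' \<phi>\<^sub>x (t (b' y + e'))\<close> is symmetric in \<open>x\<close> and \<open>y\<close>. Expanding it at \<open>t = 0\<close> gives
  \<open>m\<^sub>k x * m'\<^sub>k y = m\<^sub>k y * m'\<^sub>k x\<close> for \<open>m\<^sub>k d = E (b d + e) ^ k\<close> and \<open>m'\<^sub>k d = E' (b' d + e') ^ k\<close>,
  because the derivatives of \<open>g\<close> at \<open>0\<close> do not vanish. The case \<open>k = 1\<close> makes \<open>b\<close> and \<open>b'\<close>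
  proportional, \<open>k = 2\<close> makes the factor \<open>1\<close> or \<open>-1\<close>, and monotonicity of the cdfs excludes \<open>-1\<close>.
  For general \<open>k\<close>, \<open>m\<^sub>k\<close> and \<open>m'\<^sub>k\<close> are then proportional monic polynomials in \<open>b d\<close>, hence equal.
\<close>

section \<open>Expansions at 0 with little-o remainder\<close>

text \<open>For \<open>l > 0\<close> this is weaker than \<open>l\<close>-fold differentiability at
  0, and it passes through an expectation by dominated convergence alone. The limit says nothing
  about 0 itself, hence the separate equation \<open>f 0 = c 0\<close>.\<close>

definition peano_expansion :: "nat \<Rightarrow> (real \<Rightarrow> real) \<Rightarrow> (nat \<Rightarrow> real) \<Rightarrow> bool" where
  "peano_expansion l f c \<longleftrightarrow>
     f 0 = c 0 \<and> ((\<lambda>x. (f x - (\<Sum>k\<le>l. c k * x ^ k)) / x ^ l) \<longlongrightarrow> 0) (at 0)"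

lemma sum_powers_zero:
  fixes c :: "nat \<Rightarrow> real"
  shows "(\<Sum>k\<le>l. c k * 0 ^ k) = c 0"
proof -
  have "(\<Sum>k\<le>l. c k * 0 ^ k) = (\<Sum>k\<le>l. if k = 0 then c 0 else 0)"
    by (intro sum.cong) auto
  then show ?thesis by simp
qed

lemma peano_expansion_cong:
  assumes "peano_expansion l f c" "0 < r" "\<And>x. \<bar>x\<bar> < r \<Longrightarrow> f x = g x"
  shows "peano_expansion l g c"
proof -
  have "\<forall>\<^sub>F x in at 0. f x = g x"
    using assms(2,3) unfolding eventually_at by (intro exI[of _ r]) auto
  then have "((\<lambda>x. (f x - (\<Sum>k\<le>l. c k * x ^ k)) / x ^ l) \<longlongrightarrow> 0) (at 0) \<longleftrightarrow>
      ((\<lambda>x. (g x - (\<Sum>k\<le>l. c k * x ^ k)) / x ^ l) \<longlongrightarrow> 0) (at 0)"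
    by (intro tendsto_cong) (auto elim: eventually_mono)
  then show ?thesis
    using assms by (auto simp: peano_expansion_def)
qed

text \<open>Strong induction: once the coefficients below \<open>k\<close> are gone, multiplying by
  \<open>x ^ (l - k)\<close> leaves a polynomial in \<open>x\<close> with constant term
  \<open>a k\<close>, and its limit at 0 is its value there.\<close>

lemma polynomial_vanishing_order:
  fixes a :: "nat \<Rightarrow> real"
  assumes "((\<lambda>x. (\<Sum>k\<le>l. a k * x ^ k) / x ^ l) \<longlongrightarrow> 0) (at 0)" "k \<le> l"
  shows "a k = 0"
  using assms(2)
proof (induction k rule: less_induct)
  case (less k)
  have "((\<lambda>x. (\<Sum>j\<le>l. a j * x ^ j) / x ^ l * x ^ (l - k)) \<longlongrightarrow> 0 * 0 ^ (l - k)) (at 0)"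
    by (intro tendsto_mult assms(1) tendsto_power tendsto_ident_at)
  then have "((\<lambda>x. (\<Sum>j\<le>l. a j * x ^ j) / x ^ l * x ^ (l - k)) \<longlongrightarrow> 0) (at 0)"
    by simp
  moreover have "(\<Sum>j\<le>l. a j * x ^ j) / x ^ l * x ^ (l - k) = (\<Sum>j\<in>{k..l}. a j * x ^ (j - k))"
    if "x \<noteq> 0" for x
  proof -
    have "x ^ l = x ^ (l - k) * x ^ k"
      using less.prems by (simp flip: power_add)
    then have "(\<Sum>j\<le>l. a j * x ^ j) / x ^ l * x ^ (l - k) = (\<Sum>j\<le>l. a j * x ^ j) / x ^ k"
      using that by simp
    also have "\<dots> = (\<Sum>j\<in>{k..l}. a j * x ^ j) / x ^ k"
    proof -
      have "(\<Sum>j\<le>l. a j * x ^ j) = (\<Sum>j\<in>{k..l}. a j * x ^ j)"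
        using less by (intro sum.mono_neutral_right) auto
      then show ?thesis by simp
    qed
    also have "\<dots> = (\<Sum>j\<in>{k..l}. a j * x ^ (j - k))"
      unfolding sum_divide_distrib using that by (intro sum.cong) (auto simp: power_diff)
    finally show ?thesis .
  qed
  ultimately have "((\<lambda>x. \<Sum>j\<in>{k..l}. a j * x ^ (j - k)) \<longlongrightarrow> 0) (at 0)"
    by (subst (asm) tendsto_cong) (auto simp: eventually_at intro!: exI[of _ 1])
  moreover have "((\<lambda>x. \<Sum>j\<in>{k..l}. a j * x ^ (j - k)) \<longlongrightarrow> (\<Sum>j\<in>{k..l}. a j * 0 ^ (j - k))) (at 0)"
    by (intro tendsto_intros)
  ultimately have "(\<Sum>j\<in>{k..l}. a j * 0 ^ (j - k)) = 0"
    using tendsto_unique[OF at_neq_bot] by blast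
  moreover have "(\<Sum>j\<in>{k..l}. a j * 0 ^ (j - k)) = (\<Sum>j\<in>{k..l}. if j = k then a k else 0)"
    by (intro sum.cong) auto
  ultimately show ?case
    using less.prems by simp
qed

lemma peano_expansion_unique:
  assumes "peano_expansion l f c" "peano_expansion l f c'" "k \<le> l"
  shows "c k = c' k"
proof -
  have "((\<lambda>x. (f x - (\<Sum>k\<le>l. c' k * x ^ k)) / x ^ l - (f x - (\<Sum>k\<le>l. c k * x ^ k)) / x ^ l) \<longlongrightarrow> 0 - 0) (at 0)"
    using assms by (intro tendsto_diff) (auto simp: peano_expansion_def)
  also have "(\<lambda>x. (f x - (\<Sum>k\<le>l. c' k * x ^ k)) / x ^ l - (f x - (\<Sum>k\<le>l. c k * x ^ k)) / x ^ l) =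
      (\<lambda>x. (\<Sum>k\<le>l. (c k - c' k) * x ^ k) / x ^ l)"
    by (simp add: fun_eq_iff left_diff_distrib sum_subtractf flip: diff_divide_distrib)
  finally show ?thesis
    using polynomial_vanishing_order[of "\<lambda>k. c k - c' k"] assms(3) by fastforce
qed

text \<open>\<open>D l\<close> need not be continuous, so a Lagrange remainder of order
  \<open>l\<close> would not do. The remainder of order \<open>l - 1\<close> is combined with the
  difference quotient of \<open>D (l - 1)\<close> at 0.\<close>

lemma peano_expansion_of_derivs:
  assumes "\<And>k t. k < l \<Longrightarrow> (D k has_real_derivative D (Suc k) t) (at t)" "0 < l"
  shows "peano_expansion l (D 0) (\<lambda>k. D k 0 / fact k)"
proof -
  obtain n where l: "l = Suc n" using assms(2) by (cases l) auto
  let ?q = "\<lambda>t. (D n t - D n 0) / t - D l 0"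
  have "((\<lambda>t. (D n t - D n 0) / (t - 0)) \<longlongrightarrow> D l 0) (at 0)"
    using assms(1)[of n 0] unfolding has_field_derivative_iff l by simp
  then have q: "(?q \<longlongrightarrow> 0) (at 0)"
    by (simp add: LIM_zero)
  have "((\<lambda>x. (D 0 x - (\<Sum>k\<le>l. D k 0 / fact k * x ^ k)) / x ^ l) \<longlongrightarrow> 0) (at 0)"
  proof (rule LIM_I)
    fix \<epsilon> :: real assume "0 < \<epsilon>"
    \<comment> \<open>The remainder will only be bounded weakly; halving leaves room for the strict
      inequality at the end.\<close>
    then have "0 < \<epsilon> / 2" by simp
    from LIM_D[OF q this] obtain \<delta> where "\<delta> > 0"
      and \<delta>: "\<And>t. t \<noteq> 0 \<Longrightarrow> \<bar>t\<bar> < \<delta> \<Longrightarrow> \<bar>?q t\<bar> < \<epsilon> / 2"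
      by auto
    have "\<bar>(D 0 x - (\<Sum>k\<le>l. D k 0 / fact k * x ^ k)) / x ^ l\<bar> < \<epsilon>" if x: "x \<noteq> 0" "\<bar>x\<bar> < \<delta>" for x
    proof -
      \<comment> \<open>Maclaurin of order \<open>n\<close> is applied after removing the degree \<open>l\<close> term, because the intermediate point \<open>t\<close> need not be close to \<open>x\<close>.\<close>
      let ?E = "\<lambda>k t. D k t - D l 0 * t ^ (l - k) / fact (l - k)"
      have "DERIV (?E m) t :> ?E (Suc m) t" if "m < n" for m t
      proof -
        have "l - m = Suc (l - Suc m)" using that l by simp
        then have *: "DERIV (\<lambda>t. t ^ (l - m) / fact (l - m)) t :> t ^ (l - Suc m) / fact (l - Suc m)"
          using DERIV_cdivide[OF DERIV_pow[of "Suc (l - Suc m)" t UNIV], of "fact (Suc (l - Suc m))"]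
          by (simp add: field_simps del: of_nat_Suc of_nat_diff)
        show ?thesis
          using DERIV_diff[OF assms(1)[of m t] DERIV_cmult[OF *, of "D l 0"]] that l by simp
      qed
      with Maclaurin_bi_le[of ?E "?E 0" n x] obtain t where t: "\<bar>t\<bar> \<le> \<bar>x\<bar>"
        and eq: "?E 0 x = (\<Sum>m<n. ?E m 0 / fact m * x ^ m) + ?E n t / fact n * x ^ n"
        by auto
      have "(\<Sum>m<n. ?E m 0 / fact m * x ^ m) = (\<Sum>m<n. D m 0 / fact m * x ^ m)"
        using l by (intro sum.cong) (auto simp: zero_power)
      moreover have "(\<Sum>k\<le>l. D k 0 / fact k * x ^ k) =
          (\<Sum>m<n. D m 0 / fact m * x ^ m) + D n 0 / fact n * x ^ n + D l 0 / fact l * x ^ l"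
        unfolding l lessThan_Suc_atMost[symmetric] sum.lessThan_Suc ..
      ultimately have R: "D 0 x - (\<Sum>k\<le>l. D k 0 / fact k * x ^ k) =
          (D n t - D n 0 - D l 0 * t) / fact n * x ^ n"
        using eq by (simp add: l field_simps)
      have "\<bar>D n t - D n 0 - D l 0 * t\<bar> \<le> \<epsilon> / 2 * \<bar>t\<bar>"
      proof (cases "t = 0")
        case False
        then have "D n t - D n 0 - D l 0 * t = ?q t * t" by (simp add: field_simps)
        then show ?thesis
          using \<delta>[OF False] t x(2) mult_right_mono[of "\<bar>?q t\<bar>" "\<epsilon> / 2" "\<bar>t\<bar>"]
          by (simp add: abs_mult)
      qed simp
      also have "\<dots> \<le> \<epsilon> / 2 * \<bar>x\<bar>" using t \<open>0 < \<epsilon>\<close> by simp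
      finally have "\<bar>D n t - D n 0 - D l 0 * t\<bar> / fact n \<le> \<epsilon> / 2 * \<bar>x\<bar> / 1"
        using \<open>0 < \<epsilon>\<close> by (intro frac_le) (auto simp: fact_ge_1)
      then have "\<bar>D n t - D n 0 - D l 0 * t\<bar> / fact n * \<bar>x\<bar> ^ n \<le> \<epsilon> / 2 * \<bar>x\<bar> * \<bar>x\<bar> ^ n"
        by (intro mult_right_mono) auto
      also have "\<dots> < \<epsilon> * \<bar>x\<bar> ^ l"
        using x(1) \<open>0 < \<epsilon>\<close> by (simp add: l)
      finally show ?thesis
        unfolding R using x(1) by (simp add: abs_mult abs_divide power_abs divide_less_eq ac_simps)
    qed
    then show "\<exists>\<delta>>0. \<forall>x. x \<noteq> 0 \<and> norm (x - 0) < \<delta> \<longrightarrow>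
        norm ((D 0 x - (\<Sum>k\<le>l. D k 0 / fact k * x ^ k)) / x ^ l - 0) < \<epsilon>"
      using \<open>\<delta> > 0\<close> by auto
  qed
  then show ?thesis by (simp add: peano_expansion_def)
qed

text \<open>Near 0 the limit controls the remainder; away from 0 boundedness of \<open>f\<close>
  does, because lower powers are there at most a constant times \<open>|x| ^ l\<close>. The bound
  supplies the dominating function when an expansion is integrated.\<close>

lemma peano_remainder_bound:
  assumes "peano_expansion l f c" "0 < l" and B: "\<And>x. \<bar>f x\<bar> \<le> B"
  obtains C where "\<And>x. \<bar>f x - (\<Sum>k\<le>l. c k * x ^ k)\<bar> \<le> C * \<bar>x\<bar> ^ l"
proof -
  let ?R = "\<lambda>x. f x - (\<Sum>k\<le>l. c k * x ^ k)"
  have f0: "f 0 = c 0" and lim: "((\<lambda>x. ?R x / x ^ l) \<longlongrightarrow> 0) (at 0)"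
    using assms(1) by (auto simp: peano_expansion_def)
  from LIM_D[OF lim, of 1] obtain \<delta> where "\<delta> > 0"
    and \<delta>: "\<And>x. x \<noteq> 0 \<Longrightarrow> \<bar>x\<bar> < \<delta> \<Longrightarrow> \<bar>?R x / x ^ l\<bar> < 1" by auto
  \<comment> \<open>Collects the estimates for \<open>|x|\<close> at least \<open>\<delta>\<close>,
    where \<open>|x| ^ k\<close> is at most \<open>|x| ^ l / \<delta> ^ (l - k)\<close>: the case
    \<open>k = 0\<close> serves the bound \<open>B\<close>, the others the terms of the sum.\<close>
  define K where "K = B / \<delta> ^ l + (\<Sum>k\<le>l. \<bar>c k\<bar> / \<delta> ^ (l - k))"
  have "0 \<le> B" using B[of 0] by simp
  then have "0 \<le> K" using \<open>\<delta> > 0\<close> by (auto simp: K_def intro!: add_nonneg_nonneg sum_nonneg)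
  have "\<bar>?R x\<bar> \<le> (1 + K) * \<bar>x\<bar> ^ l" for x
  proof -
    consider "x = 0" | "x \<noteq> 0" "\<bar>x\<bar> < \<delta>" | "\<delta> \<le> \<bar>x\<bar>" by force
    then show ?thesis
    proof cases
      case 1
      then show ?thesis by (simp add: f0 sum_powers_zero zero_power \<open>0 < l\<close>)
    next
      case 2
      then have "\<bar>?R x\<bar> \<le> \<bar>x\<bar> ^ l"
        using \<delta>[OF 2] by (simp add: abs_divide power_abs divide_less_eq)
      also have "\<dots> \<le> (1 + K) * \<bar>x\<bar> ^ l"
        using \<open>0 \<le> K\<close> by (simp add: mult_left_le_one_le algebra_simps)
      finally show ?thesis .
    next
      case 3
      have pw: "\<bar>x\<bar> ^ k \<le> \<bar>x\<bar> ^ l / \<delta> ^ (l - k)" if "k \<le> l" for k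
      proof -
        have "\<bar>x\<bar> ^ k * \<delta> ^ (l - k) \<le> \<bar>x\<bar> ^ k * \<bar>x\<bar> ^ (l - k)"
          using 3 \<open>\<delta> > 0\<close> by (intro mult_left_mono power_mono) auto
        then show ?thesis
          using that \<open>\<delta> > 0\<close> by (simp add: field_simps flip: power_add)
      qed
      have "\<bar>?R x\<bar> \<le> B + (\<Sum>k\<le>l. \<bar>c k * x ^ k\<bar>)"
        using B[of x] sum_abs[of "\<lambda>k. c k * x ^ k" "{..l}"] by linarith
      also have "\<dots> \<le> B * (\<bar>x\<bar> ^ l / \<delta> ^ l) + (\<Sum>k\<le>l. \<bar>c k\<bar> * (\<bar>x\<bar> ^ l / \<delta> ^ (l - k)))"
      proof (intro add_mono sum_mono)
        show "B \<le> B * (\<bar>x\<bar> ^ l / \<delta> ^ l)"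
          using mult_left_mono[OF pw[of 0] \<open>0 \<le> B\<close>] by simp
        show "\<bar>c k * x ^ k\<bar> \<le> \<bar>c k\<bar> * (\<bar>x\<bar> ^ l / \<delta> ^ (l - k))" if "k \<in> {..l}" for k
          using mult_left_mono[OF pw[of k] abs_ge_zero[of "c k"]] that by (simp add: abs_mult power_abs)
      qed
      also have "\<dots> = K * \<bar>x\<bar> ^ l"
        by (simp add: K_def distrib_right sum_distrib_right)
      also have "\<dots> \<le> (1 + K) * \<bar>x\<bar> ^ l"
        by (simp add: algebra_simps)
      finally show ?thesis .
    qed
  qed
  then show ?thesis using that by blast
qed

section \<open>Integrating the expansion of a bounded function\<close>

lemma (in prob_space) integrable_power_le:
  fixes X :: "'a \<Rightarrow> real"
  assumes [measurable]: "X \<in> borel_measurable M" and "integrable M (\<lambda>x. X x ^ l)" "k \<le> l"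
  shows "integrable M (\<lambda>x. X x ^ k)"
proof (rule Bochner_Integration.integrable_bound)
  show "integrable M (\<lambda>x. 1 + \<bar>X x ^ l\<bar>)"
    using assms(2) by (intro Bochner_Integration.integrable_add integrable_abs) auto
  have "\<bar>y\<bar> ^ k \<le> 1 + \<bar>y\<bar> ^ l" for y :: real
  proof (cases "\<bar>y\<bar> \<le> 1")
    case True
    then have "\<bar>y\<bar> ^ k \<le> 1" by (simp add: power_le_one)
    then show ?thesis using zero_le_power_abs[of y l] by linarith
  next
    case False
    then show ?thesis using power_increasing[OF assms(3), of "\<bar>y\<bar>"] by linarith
  qed
  then show "AE x in M. norm (X x ^ k) \<le> norm (1 + \<bar>X x ^ l\<bar>)"
    by (simp add: power_abs)
qed simp

text \<open>Dominated convergence: the remainder at \<open>t * X\<close>, divided by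
  \<open>t ^ l\<close>, tends to 0 pointwise and is bounded by a constant times
  \<open>|X| ^ l\<close>.\<close>

lemma (in prob_space) peano_expansion_expectation:
  fixes X :: "'a \<Rightarrow> real"
  assumes [measurable]: "X \<in> borel_measurable M" "f \<in> borel_measurable borel"
    and int: "integrable M (\<lambda>x. X x ^ l)" and "0 < l"
    and f: "peano_expansion l f c" and B: "\<And>x. \<bar>f x\<bar> \<le> B"
  shows "peano_expansion l (\<lambda>t. expectation (\<lambda>x. f (t * X x))) (\<lambda>k. c k * expectation (\<lambda>x. X x ^ k))"
proof -
  let ?R = "\<lambda>x. f x - (\<Sum>k\<le>l. c k * x ^ k)"
  obtain C where C: "\<And>x. \<bar>?R x\<bar> \<le> C * \<bar>x\<bar> ^ l"
    using peano_remainder_bound[OF f \<open>0 < l\<close> B] by blast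
  have f0: "f 0 = c 0" and lim: "((\<lambda>x. ?R x / x ^ l) \<longlongrightarrow> 0) (at 0)"
    using f by (auto simp: peano_expansion_def)
  have intk: "integrable M (\<lambda>x. X x ^ k)" if "k \<le> l" for k
    using integrable_power_le[OF _ int that] by simp
  have intf: "integrable M (\<lambda>x. f (t * X x))" for t
    using B by (intro integrable_const_bound[of _ B]) auto
  \<comment> \<open>By linearity the expected remainder is itself the remainder of the new
    expansion, so only its limit is left to show.\<close>
  have ER: "expectation (\<lambda>x. ?R (t * X x)) =
      expectation (\<lambda>x. f (t * X x)) - (\<Sum>k\<le>l. c k * expectation (\<lambda>x. X x ^ k) * t ^ k)" for t
  proof -
    have i: "integrable M (\<lambda>x. c k * t ^ k * X x ^ k)" if "k \<in> {..l}" for k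
      using intk[of k] that by (intro integrable_mult_right) auto
    have "expectation (\<lambda>x. ?R (t * X x)) =
        expectation (\<lambda>x. f (t * X x) - (\<Sum>k\<le>l. c k * t ^ k * X x ^ k))"
      by (simp only: power_mult_distrib mult.assoc)
    also have "\<dots> = expectation (\<lambda>x. f (t * X x)) - expectation (\<lambda>x. \<Sum>k\<le>l. c k * t ^ k * X x ^ k)"
      using intf i by (intro Bochner_Integration.integral_diff Bochner_Integration.integrable_sum)
    also have "expectation (\<lambda>x. \<Sum>k\<le>l. c k * t ^ k * X x ^ k) =
        (\<Sum>k\<le>l. c k * expectation (\<lambda>x. X x ^ k) * t ^ k)"
      using i by (subst Bochner_Integration.integral_sum) (simp_all add: ac_simps)
    finally show ?thesis .
  qed
  have "((\<lambda>t. expectation (\<lambda>x. ?R (t * X x) / t ^ l)) \<longlongrightarrow> 0) (at 0)"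
    unfolding tendsto_at_iff_sequentially comp_def
  proof (intro allI impI)
    fix T :: "nat \<Rightarrow> real"
    assume T: "\<forall>i. T i \<in> UNIV - {0}" "T \<longlonglongrightarrow> 0"
    have "(\<lambda>i. expectation (\<lambda>x. ?R (T i * X x) / T i ^ l)) \<longlonglongrightarrow> expectation (\<lambda>x. 0)"
    proof (rule integral_dominated_convergence)
      show "integrable M (\<lambda>x. C * \<bar>X x ^ l\<bar>)"
        using int by (intro integrable_mult_right integrable_abs)
      show "AE x in M. (\<lambda>i. ?R (T i * X x) / T i ^ l) \<longlonglongrightarrow> 0"
      proof (intro AE_I2)
        fix x
        show "(\<lambda>i. ?R (T i * X x) / T i ^ l) \<longlonglongrightarrow> 0"
        \<comment> \<open>If \<open>X x = 0\<close> the argument stays at 0, which the punctured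
          limit does not see; there the remainder vanishes by \<open>f 0 = c 0\<close>.\<close>
        proof (cases "X x = 0")
          case True
          then show ?thesis by (simp add: f0 sum_powers_zero)
        next
          case False
          have "(\<lambda>i. T i * X x) \<longlonglongrightarrow> 0"
            using tendsto_mult_right[OF T(2), of "X x"] by simp
          then have "filterlim (\<lambda>i. T i * X x) (at 0) sequentially"
            using T(1) False by (simp add: filterlim_at)
          then have "(\<lambda>i. ?R (T i * X x) / (T i * X x) ^ l) \<longlonglongrightarrow> 0"
            by (rule filterlim_compose[OF lim])
          from tendsto_mult_right[OF this, of "X x ^ l"]
          have "(\<lambda>i. ?R (T i * X x) / (T i * X x) ^ l * X x ^ l) \<longlonglongrightarrow> 0" by (simp only: mult_zero_left)
          moreover have "a / (T i * X x) ^ l * X x ^ l = a / T i ^ l" for a i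
            using False by (simp add: power_mult_distrib)
          ultimately show ?thesis by (simp only:)
        qed
      qed
      show "(\<lambda>x. 0) \<in> borel_measurable M" by simp
      fix i
      show "(\<lambda>x. ?R (T i * X x) / T i ^ l) \<in> borel_measurable M" by measurable
      show "AE x in M. norm (?R (T i * X x) / T i ^ l) \<le> C * \<bar>X x ^ l\<bar>"
      proof (intro AE_I2)
        fix x
        have "\<bar>?R (T i * X x)\<bar> \<le> C * \<bar>X x ^ l\<bar> * \<bar>T i\<bar> ^ l"
        proof -
          have "C * \<bar>T i * X x\<bar> ^ l = C * \<bar>X x ^ l\<bar> * \<bar>T i\<bar> ^ l"
            by (simp only: abs_mult power_mult_distrib power_abs ac_simps)
          then show ?thesis using C[of "T i * X x"] by (simp only:)
        qed
        moreover have "0 < \<bar>T i\<bar> ^ l" using T(1) by simp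
        ultimately show "norm (?R (T i * X x) / T i ^ l) \<le> C * \<bar>X x ^ l\<bar>"
          by (simp only: real_norm_def abs_divide power_abs pos_divide_le_eq)
      qed
    qed
    then show "(\<lambda>i. expectation (\<lambda>x. ?R (T i * X x) / T i ^ l)) \<longlonglongrightarrow> 0" by simp
  qed
  then show ?thesis
    unfolding integral_divide_zero ER by (simp add: peano_expansion_def f0 prob_space)
qed


section \<open>Moments of a shifted variable as polynomials in the shift\<close>

lemma (in prob_space) integrable_shifted_power:
  fixes X :: "'a \<Rightarrow> real"
  assumes "X \<in> borel_measurable M" "integrable M (\<lambda>x. X x ^ l)"
  shows "integrable M (\<lambda>x. (u + X x) ^ l)"
  unfolding binomial_ring using integrable_power_le[OF assms]
  by (intro Bochner_Integration.integrable_sum integrable_mult_right) auto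

text \<open>The coefficient of \<open>u ^ l\<close> is the expectation of the constant 1, so the
  polynomial is monic whatever the law of \<open>X\<close>.\<close>

lemma (in prob_space) expectation_shifted_power:
  fixes X :: "'a \<Rightarrow> real"
  assumes "X \<in> borel_measurable M" "integrable M (\<lambda>x. X x ^ l)"
  shows "expectation (\<lambda>x. (u + X x) ^ l) =
    poly (\<Sum>k\<le>l. monom (of_nat (l choose k) * expectation (\<lambda>x. X x ^ (l - k))) k) u"
  unfolding binomial_ring using integrable_power_le[OF assms]
  by (subst Bochner_Integration.integral_sum) (auto simp: poly_sum poly_monom ac_simps)

text \<open>Both shifted moments are monic polynomials of degree \<open>l\<close> in the shift.
  Proportionality on an infinite set is proportionality everywhere, the leading coefficients force
  the factor 1, and the value at 0 is the unshifted moment.\<close>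

lemma moment_eq_if_shifted_moments_proportional:
  fixes M N :: "real measure"
  assumes "prob_space M" "sets M = sets borel" "integrable M (\<lambda>e. e ^ l)"
    and "prob_space N" "sets N = sets borel" "integrable N (\<lambda>e. e ^ l)"
    and "infinite S"
    and crossed: "\<And>x y. x \<in> S \<Longrightarrow> y \<in> S \<Longrightarrow>
      (\<integral>e. (x + e) ^ l \<partial>M) * (\<integral>e. (y + e) ^ l \<partial>N) = (\<integral>e. (y + e) ^ l \<partial>M) * (\<integral>e. (x + e) ^ l \<partial>N)"
  shows "(\<integral>e. e ^ l \<partial>M) = (\<integral>e. e ^ l \<partial>N)"
proof -
  interpret M: prob_space M by fact
  interpret N: prob_space N by fact
  define p where "p L = (\<Sum>k\<le>l. monom (of_nat (l choose k) * (\<integral>e. e ^ (l - k) \<partial>L)) k)"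
    for L :: "real measure"
  have pM: "(\<integral>e. (u + e) ^ l \<partial>M) = poly (p M) u" for u
    using M.expectation_shifted_power[of "\<lambda>e. e" l u] assms by (simp add: p_def cong: measurable_cong_sets)
  have pN: "(\<integral>e. (u + e) ^ l \<partial>N) = poly (p N) u" for u
    using N.expectation_shifted_power[of "\<lambda>e. e" l u] assms by (simp add: p_def cong: measurable_cong_sets)
  have "coeff (p M) l = 1" "coeff (p N) l = 1"
    by (auto simp: p_def coeff_sum M.prob_space N.prob_space)
  then have "p N \<noteq> 0" by auto
  \<comment> \<open>A point of \<open>S\<close> off the finitely many roots, so that the factor of
    proportionality can be cancelled.\<close>
  then obtain y where y: "y \<in> S" "poly (p N) y \<noteq> 0"
    using \<open>infinite S\<close> poly_roots_finite[of "p N"] by (metis (mono_tags, lifting) finite_subset mem_Collect_eq subsetI)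
  let ?q = "smult (poly (p N) y) (p M) - smult (poly (p M) y) (p N)"
  have "S \<subseteq> {x. poly ?q x = 0}"
  proof (intro subsetI CollectI)
    fix x assume "x \<in> S"
    then show "poly ?q x = 0" using crossed[of x y] y(1) by (simp add: pM pN mult.commute)
  qed
  then have q: "?q = 0"
    using \<open>infinite S\<close> poly_roots_finite[of ?q] finite_subset by blast
  then have "coeff ?q l = 0" by simp
  then have "poly (p N) y = poly (p M) y"
    using \<open>coeff (p M) l = 1\<close> \<open>coeff (p N) l = 1\<close> by simp
  moreover have "poly ?q 0 = 0" using q by simp
  ultimately show ?thesis
    using y(2) pM[of 0] pN[of 0] by simp
qed

section \<open>Crossed moment identities from Fubini\<close>

text \<open>\<open>h\<close> is not assumed to have an expansion, but its average
  \<open>\<phi> v\<close> inherits one from \<open>g\<close>. Averaging \<open>\<phi>\<close> once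
  more over \<open>N\<close> gives a double integral symmetric in \<open>v1\<close> and
  \<open>v2\<close>; uniqueness of its expansion equates the coefficients. The factor
  \<open>c k\<close> is left for the caller to cancel.\<close>

lemma crossed_moments:
  fixes M N :: "real measure"
  assumes "prob_space M" and sM[measurable_cong]: "sets M = sets borel" and "integrable M (\<lambda>e. e ^ l)"
    and "prob_space N" and sN[measurable_cong]: "sets N = sets borel" and "integrable N (\<lambda>e. e ^ l)"
    and [measurable]: "g \<in> borel_measurable borel" "h \<in> borel_measurable borel"
    and B: "\<And>x. \<bar>g x\<bar> \<le> B" "\<And>x. \<bar>h x\<bar> \<le> B"
    and g: "peano_expansion l g c" and "0 < l" "0 < r"
    and eq1: "\<And>t. \<bar>t\<bar> < r \<Longrightarrow> (\<integral>e. g (t * (u1 + e)) \<partial>M) = (\<integral>e. h (t * (v1 + e)) \<partial>N)"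
    and eq2: "\<And>t. \<bar>t\<bar> < r \<Longrightarrow> (\<integral>e. g (t * (u2 + e)) \<partial>M) = (\<integral>e. h (t * (v2 + e)) \<partial>N)"
    and "k \<le> l"
  shows "c k * (\<integral>e. (u1 + e) ^ k \<partial>M) * (\<integral>e. (v2 + e) ^ k \<partial>N) =
    c k * (\<integral>e. (u2 + e) ^ k \<partial>M) * (\<integral>e. (v1 + e) ^ k \<partial>N)"
proof -
  interpret M: prob_space M by fact
  interpret N: prob_space N by fact
  interpret NN: pair_prob_space N N ..
  define \<phi> where "\<phi> v t = (\<integral>e. h (t * (v + e)) \<partial>N)" for v t
  have [measurable]: "\<phi> v \<in> borel_measurable borel" for v
    unfolding \<phi>_def by measurable
  \<comment> \<open>A global bound is required for the second averaging, whereas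
    \<open>\<phi> v\<close> agrees with the average of \<open>g\<close> only for
    \<open>|t| < r\<close>.\<close>
  have \<phi>B: "\<bar>\<phi> v t\<bar> \<le> B" for v t
  proof -
    have "integrable N (\<lambda>e. h (t * (v + e)))"
      using B by (intro N.integrable_const_bound[of _ B]) auto
    then have "\<bar>\<phi> v t\<bar> \<le> (\<integral>e. B \<partial>N)"
      unfolding \<phi>_def using B by (intro order_trans[OF integral_abs_bound] integral_mono) auto
    then show ?thesis by (simp add: N.prob_space)
  qed
  have iM: "integrable M (\<lambda>e. (u + e) ^ l)" for u
    using M.integrable_shifted_power[of "\<lambda>e. e" l u] assms by simp
  have iN: "integrable N (\<lambda>e. (u + e) ^ l)" for u
    using N.integrable_shifted_power[of "\<lambda>e. e" l u] assms by simp
  have \<phi>: "peano_expansion l (\<lambda>t. \<integral>e'. \<phi> v (t * (v' + e')) \<partial>N)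
      (\<lambda>k. c k * (\<integral>e. (u + e) ^ k \<partial>M) * (\<integral>e. (v' + e) ^ k \<partial>N))"
    if "\<And>t. \<bar>t\<bar> < r \<Longrightarrow> (\<integral>e. g (t * (u + e)) \<partial>M) = \<phi> v t" for u v v'
  proof -
    have "peano_expansion l (\<lambda>t. \<integral>e. g (t * (u + e)) \<partial>M) (\<lambda>k. c k * (\<integral>e. (u + e) ^ k \<partial>M))"
      by (rule M.peano_expansion_expectation[OF _ _ iM \<open>0 < l\<close> g B(1)]) auto
    then have "peano_expansion l (\<phi> v) (\<lambda>k. c k * (\<integral>e. (u + e) ^ k \<partial>M))"
      by (rule peano_expansion_cong[OF _ \<open>0 < r\<close> that])
    then show ?thesis
      by (intro N.peano_expansion_expectation[OF _ _ iN \<open>0 < l\<close> _ \<phi>B]) auto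
  qed
  \<comment> \<open>Both sides integrate \<open>h (t * (v1 + e) * (v2 + e'))\<close> over two
    independent copies of \<open>N\<close>, in opposite orders.\<close>
  have "(\<integral>e'. \<phi> v1 (t * (v2 + e')) \<partial>N) = (\<integral>e'. \<phi> v2 (t * (v1 + e')) \<partial>N)" for t
  proof -
    have "integrable (N \<Otimes>\<^sub>M N) (\<lambda>(e, e'). h (t * (v2 + e') * (v1 + e)))"
      using B by (intro NN.integrable_const_bound[of _ B]) auto
    from NN.Fubini_integral[OF this] show ?thesis
      by (simp add: \<phi>_def ac_simps)
  qed
  then show ?thesis
    using peano_expansion_unique[OF \<phi>[of u1 v1 v2] _ \<open>k \<le> l\<close>] \<phi>[of u2 v2 v1] eq1 eq2
    unfolding \<phi>_def by simp
qed

section \<open>Sign and scale of the affine index\<close>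

text \<open>As \<open>e\<close> has mean zero, the average of \<open>g (t * (u + e))\<close> has
  right derivative \<open>c 1 * u\<close> at 0. Monotonicity of \<open>h\<close> orders the averages
  for \<open>t > 0\<close>, hence their slopes.\<close>

lemma index_mono:
  fixes M N :: "real measure"
  assumes "prob_space M" and sM[measurable_cong]: "sets M = sets borel" and iM: "integrable M (\<lambda>e. e)"
    and mean: "(\<integral>e. e \<partial>M) = 0"
    and "prob_space N" and sN[measurable_cong]: "sets N = sets borel"
    and "mono g" "mono h"
    and B: "\<And>x. \<bar>g x\<bar> \<le> B" "\<And>x. \<bar>h x\<bar> \<le> B"
    and g: "peano_expansion 1 g c" and "c 1 \<noteq> 0" "0 < r"
    and eq1: "\<And>t. \<bar>t\<bar> < r \<Longrightarrow> (\<integral>e. g (t * (u1 + e)) \<partial>M) = (\<integral>e. h (t * (v1 + e)) \<partial>N)"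
    and eq2: "\<And>t. \<bar>t\<bar> < r \<Longrightarrow> (\<integral>e. g (t * (u2 + e)) \<partial>M) = (\<integral>e. h (t * (v2 + e)) \<partial>N)"
    and "v1 \<le> v2"
  shows "u1 \<le> u2"
proof -
  interpret M: prob_space M by fact
  interpret N: prob_space N by fact
  have [measurable]: "g \<in> borel_measurable borel" "h \<in> borel_measurable borel"
    using \<open>mono g\<close> \<open>mono h\<close> by (auto intro: borel_measurable_mono)
  have quot: "((\<lambda>t. (f t - f 0) / t) \<longlongrightarrow> a 1) (at_right 0)" if "peano_expansion 1 f a" for f a
  proof -
    have "((\<lambda>t. (f t - (\<Sum>k\<le>1. a k * t ^ k)) / t ^ 1 + a 1) \<longlongrightarrow> 0 + a 1) (at_right 0)"
      using that unfolding peano_expansion_def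
      by (intro tendsto_add tendsto_const) (auto intro: filterlim_mono at_le)
    moreover have "(f t - (\<Sum>k\<le>1. a k * t ^ k)) / t ^ 1 + a 1 = (f t - f 0) / t" if "0 < t" for t
      using \<open>peano_expansion 1 f a\<close> that by (simp add: peano_expansion_def field_simps)
    then have "\<forall>\<^sub>F t in at_right 0. (f t - (\<Sum>k\<le>1. a k * t ^ k)) / t ^ 1 + a 1 = (f t - f 0) / t"
      by (rule eventually_mono[OF eventually_at_right_less])
    ultimately show ?thesis
      using Lim_transform_eventually by fastforce
  qed
  have pos: "\<forall>\<^sub>F t in at_right 0. 0 < t \<and> \<bar>t\<bar> < r"
    using \<open>0 < r\<close> eventually_at_right_real[of 0 r] by (auto elim: eventually_mono)
  \<comment> \<open>Monotonicity of \<open>g\<close> gives the weak sign;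
    \<open>c 1 \<noteq> 0\<close> then makes it strict, so that \<open>c 1\<close> can be cancelled
    from an inequality.\<close>
  have "0 \<le> c 1"
  proof (rule tendsto_lowerbound[OF quot[OF g]])
    show "\<forall>\<^sub>F t in at_right 0. 0 \<le> (g t - g 0) / t"
      using pos
    proof (rule eventually_mono)
      fix t :: real assume "0 < t \<and> \<bar>t\<bar> < r"
      then show "0 \<le> (g t - g 0) / t" using monoD[OF \<open>mono g\<close>, of 0 t] by simp
    qed
  qed simp
  with \<open>c 1 \<noteq> 0\<close> have "0 < c 1" by simp
  define \<phi> where "\<phi> u t = (\<integral>e. g (t * (u + e)) \<partial>M)" for u t
  have \<phi>: "((\<lambda>t. (\<phi> u t - \<phi> u 0) / t) \<longlongrightarrow> c 1 * u) (at_right 0)" for u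
  proof -
    have "integrable M (\<lambda>e. (u + e) ^ 1)" using iM by simp
    from M.peano_expansion_expectation[OF _ _ this _ g B(1)]
    have "peano_expansion 1 (\<phi> u) (\<lambda>k. c k * (\<integral>e. (u + e) ^ k \<partial>M))"
      by (simp add: \<phi>_def[abs_def])
    from quot[OF this] show ?thesis
      using iM by (simp add: mean M.prob_space)
  qed
  have "c 1 * u1 \<le> c 1 * u2"
  proof (rule tendsto_le[OF _ \<phi> \<phi>])
    show "\<forall>\<^sub>F t in at_right 0. (\<phi> u1 t - \<phi> u1 0) / t \<le> (\<phi> u2 t - \<phi> u2 0) / t"
      using pos
    proof (rule eventually_mono)
      fix t :: real assume t: "0 < t \<and> \<bar>t\<bar> < r"
      have i: "integrable N (\<lambda>e. h (t * (v + e)))" for v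
        using B by (intro N.integrable_const_bound[of _ B]) auto
      have "(\<integral>e. h (t * (v1 + e)) \<partial>N) \<le> (\<integral>e. h (t * (v2 + e)) \<partial>N)"
      proof (intro integral_mono i monoD[OF \<open>mono h\<close>])
        show "t * (v1 + e) \<le> t * (v2 + e)" for e
          using t \<open>v1 \<le> v2\<close> by (intro mult_left_mono) auto
      qed
      then have "\<phi> u1 t \<le> \<phi> u2 t" using eq1[of t] eq2[of t] t unfolding \<phi>_def by linarith
      moreover have "\<phi> u1 0 = \<phi> u2 0" by (simp add: \<phi>_def)
      ultimately show "(\<phi> u1 t - \<phi> u1 0) / t \<le> (\<phi> u2 t - \<phi> u2 0) / t"
        using t by (simp add: divide_right_mono)
    qed
  qed simp
  then show ?thesis using \<open>0 < c 1\<close> by simp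
qed

text \<open>First moments give a common ratio \<open>q\<close> of the two indices. Second moments,
  in which the added 1 is the variance, are not homogeneous in the index and leave only
  \<open>q = 1\<close> or \<open>q = -1\<close>; the order rules out \<open>-1\<close>.\<close>

lemma affine_index_unique:
  fixes \<beta>0 \<beta>1 \<gamma>0 \<gamma>1 d r :: real
  assumes "\<beta>1 \<noteq> 0" "\<gamma>1 \<noteq> 0" "0 < r"
    and lin: "\<And>x y. \<bar>x - d\<bar> < r \<Longrightarrow> \<bar>y - d\<bar> < r \<Longrightarrow>
      (\<beta>0 + \<beta>1 * x) * (\<gamma>0 + \<gamma>1 * y) = (\<beta>0 + \<beta>1 * y) * (\<gamma>0 + \<gamma>1 * x)"
    and quad: "\<And>x y. \<bar>x - d\<bar> < r \<Longrightarrow> \<bar>y - d\<bar> < r \<Longrightarrow>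
      ((\<beta>0 + \<beta>1 * x)\<^sup>2 + 1) * ((\<gamma>0 + \<gamma>1 * y)\<^sup>2 + 1) = ((\<beta>0 + \<beta>1 * y)\<^sup>2 + 1) * ((\<gamma>0 + \<gamma>1 * x)\<^sup>2 + 1)"
    and mono: "\<And>x y. \<bar>x - d\<bar> < r \<Longrightarrow> \<bar>y - d\<bar> < r \<Longrightarrow>
      \<gamma>0 + \<gamma>1 * x \<le> \<gamma>0 + \<gamma>1 * y \<Longrightarrow> \<beta>0 + \<beta>1 * x \<le> \<beta>0 + \<beta>1 * y"
  shows "\<beta>0 = \<gamma>0 \<and> \<beta>1 = \<gamma>1"
proof -
  define q where "q = \<beta>1 / \<gamma>1"
  \<comment> \<open>The crossed difference in \<open>lin\<close> is the determinant of the
    coefficients times \<open>y - x\<close>, here \<open>r / 2\<close>.\<close>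
  have "(\<beta>0 * \<gamma>1 - \<beta>1 * \<gamma>0) * (r / 2) = 0"
    using lin[of d "d + r / 2"] \<open>0 < r\<close> by (simp add: algebra_simps)
  then have b0: "\<beta>0 = q * \<gamma>0" and b1: "\<beta>1 = q * \<gamma>1"
    using assms(1-3) by (auto simp: q_def field_simps)
  let ?v = "\<lambda>x. \<gamma>0 + \<gamma>1 * x"
  have b: "\<beta>0 + \<beta>1 * x = q * ?v x" for x by (simp add: b0 b1 algebra_simps)
  have *: "(q\<^sup>2 - 1) * ((?v x)\<^sup>2 - (?v y)\<^sup>2) = 0" if "\<bar>x - d\<bar> < r" "\<bar>y - d\<bar> < r" for x y
  proof -
    have "(q\<^sup>2 - 1) * (u\<^sup>2 - v\<^sup>2) = 0"
      if "((q * u)\<^sup>2 + 1) * (v\<^sup>2 + 1) = ((q * v)\<^sup>2 + 1) * (u\<^sup>2 + 1)" for u v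
      using that by algebra
    then show ?thesis using quad[OF that] unfolding b by blast
  qed
  have "q\<^sup>2 = 1"
  proof (rule ccontr)
    assume "q\<^sup>2 \<noteq> 1"
    then have sq: "(?v x)\<^sup>2 = (?v y)\<^sup>2" if "\<bar>x - d\<bar> < r" "\<bar>y - d\<bar> < r" for x y
      using *[OF that] by auto
    \<comment> \<open>Adding the equations at equal distances on both sides of \<open>d\<close>
      cancels the mixed terms and leaves the square of the increment.\<close>
    have "(?v d)\<^sup>2 = (?v d + \<gamma>1 * (r / 2))\<^sup>2" "(?v d)\<^sup>2 = (?v d - \<gamma>1 * (r / 2))\<^sup>2"
      using sq[of d "d + r / 2"] sq[of d "d - r / 2"] \<open>0 < r\<close>
      by (simp_all add: distrib_left right_diff_distrib add_diff_eq flip: add.assoc)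
    then have "(\<gamma>1 * (r / 2))\<^sup>2 = 0" unfolding power2_sum power2_diff by linarith
    then show False using assms(2,3) by simp
  qed
  \<comment> \<open>The two test points are taken in the order in which the \<open>\<gamma>\<close>
    index increases, so \<open>mono\<close> gives \<open>\<beta>1\<close> the sign of
    \<open>\<gamma>1\<close>.\<close>
  moreover have "0 \<le> q"
  proof (cases "0 < \<gamma>1")
    case True
    then show ?thesis
      using mono[of d "d + r / 2"] \<open>0 < r\<close> by (simp add: q_def algebra_simps mult_le_cancel_left_pos zero_le_mult_iff zero_le_divide_iff)
  next
    case False
    then have "\<gamma>1 < 0" using assms(2) by simp
    then show ?thesis
      using mono[of "d + r / 2" d] \<open>0 < r\<close>
      by (auto simp: q_def zero_le_divide_iff algebra_simps mult_le_0_iff)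
  qed
  ultimately have "q = 1" by (auto simp: power2_eq_1_iff)
  then show ?thesis by (simp add: b0 b1)
qed

section \<open>From the model to functions on a coordinate axis\<close>

text \<open>Moving up an axis enlarges the orthant. This holds on every axis, so it also covers a
  structure on an axis along which it is not known to be smooth.\<close>

lemma joint_cdf_ray:
  assumes "prob_space M" "sets M = sets borel"
  shows "mono (\<lambda>t. joint_cdf M (t *\<^sub>R axis y 1))" "\<bar>joint_cdf M x\<bar> \<le> 1"
proof -
  interpret prob_space M by fact
  have "closed {v. \<forall>j. v $ j \<le> z $ j}" for z :: "real^'a"
    by (intro closed_Collect_all closed_Collect_le continuous_intros)
  then have ev: "{v. \<forall>j. v $ j \<le> z $ j} \<in> events" for z :: "real^'a"
    using assms(2) by auto
  then show "mono (\<lambda>t. joint_cdf M (t *\<^sub>R axis y 1))"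
    unfolding joint_cdf_def
    by (intro monoI finite_measure_mono ev) (auto simp: axis_def intro: order_trans split: if_splits)
  show "\<bar>joint_cdf M x\<bar> \<le> 1" by (simp add: joint_cdf_def)
qed

lemma peano_expansion_along:
  assumes "bounded_partials \<kappa> y F" "enat l \<le> \<kappa>" "0 < l"
  shows "peano_expansion l (\<lambda>t. F (t *\<^sub>R axis y 1)) (\<lambda>k. (partial_deriv y ^^ k) F 0 / fact k)"
proof -
  let ?D = "\<lambda>k t. (partial_deriv y ^^ k) F (t *\<^sub>R axis y 1)"
  have "(?D k has_real_derivative ?D (Suc k) t) (at t)" if "k < l" for k t
  proof -
    let ?h = "along y ((partial_deriv y ^^ k) F) (t *\<^sub>R axis y 1)"
    \<comment> \<open>Differentiability is given for orders strictly below \<open>\<kappa>\<close>;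
      \<open>k < l\<close> and \<open>l \<le> \<kappa>\<close> keep within that range, also for
      infinite \<open>\<kappa>\<close>.\<close>
    have "enat k < \<kappa>" using that assms(2) by (metis enat_ord_simps(2) less_le_trans)
    then have "?h differentiable at 0"
      using assms(1) by (auto simp: bounded_partials_def)
    then have "(?h has_real_derivative ?D (Suc k) t) (at (t - t))"
      by (simp add: partial_deriv_def DERIV_deriv_iff_real_differentiable)
    \<comment> \<open>\<open>partial_deriv\<close> differentiates at parameter 0 from a moving base
      point; translating by \<open>t\<close> turns this into a derivative at \<open>t\<close> along
      one fixed line.\<close>
    then have "((\<lambda>x. ?h (x - t)) has_real_derivative ?D (Suc k) t) (at t)"
      using DERIV_shift[of ?h "?D (Suc k) t" t "- t"] by simp
    then show ?thesis
      by (simp add: along_def flip: scaleR_add_left)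
  qed
  from peano_expansion_of_derivs[of l ?D, OF this \<open>0 < l\<close>] show ?thesis by simp
qed


lemma e_law_facts:
  assumes "admissible \<kappa> W Q s" "w \<in> W"
  shows "prob_space (e_law s w)" "sets (e_law s w) = sets borel"
    "prob_space (eps_law s w)" "sets (eps_law s w) = sets borel"
    "moment_exists s l w \<longleftrightarrow> integrable (e_law s w) (\<lambda>e. e ^ l)"
    "moment s l w = (\<integral>e. e ^ l \<partial>e_law s w)"
    "integrable (e_law s w) (\<lambda>e. e)" "integrable (e_law s w) (\<lambda>e. e\<^sup>2)"
    "(\<integral>e. e \<partial>e_law s w) = 0" "(\<integral>e. e\<^sup>2 \<partial>e_law s w) = 1"
proof -
  have P: "prob_space (law s w)"
    and [measurable]: "rv_e \<in> borel_measurable (law s w)" "rv_eps \<in> borel_measurable (law s w)"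
    and n: "integrable (law s w) rv_e" "integrable (law s w) (\<lambda>\<omega>. (rv_e \<omega>)\<^sup>2)"
      "(\<integral>\<omega>. rv_e \<omega> \<partial>law s w) = 0" "(\<integral>\<omega>. (rv_e \<omega> - (\<integral>\<omega>. rv_e \<omega> \<partial>law s w))\<^sup>2 \<partial>law s w) = 1"
    using assms
    by (auto simp: admissible_def model_on_def latent_independence_def normalized_def indep_rvs_def)
  show "prob_space (e_law s w)" "prob_space (eps_law s w)"
    unfolding e_law_def eps_law_def by (auto intro!: prob_space.prob_space_distr[OF P])
  show "sets (e_law s w) = sets borel" "sets (eps_law s w) = sets borel"
    by (auto simp: e_law_def eps_law_def)
  show "moment_exists s l w \<longleftrightarrow> integrable (e_law s w) (\<lambda>e. e ^ l)"
    "moment s l w = (\<integral>e. e ^ l \<partial>e_law s w)"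
    by (simp_all add: moment_exists_def moment_def e_law_def integrable_distr_eq integral_distr)
  show "integrable (e_law s w) (\<lambda>e. e)" "integrable (e_law s w) (\<lambda>e. e\<^sup>2)"
    "(\<integral>e. e \<partial>e_law s w) = 0" "(\<integral>e. e\<^sup>2 \<partial>e_law s w) = 1"
    using n by (simp_all add: e_law_def integrable_distr_eq integral_distr)
qed

text \<open>The minus sign in \<open>z\<close> cancels the one in the argument of the cdf, and the
  other components of \<open>z\<close> are 0, so only the restriction of the cdf to one axis
  enters.\<close>

lemma p0_axis:
  "p0 s (d, - t *\<^sub>R axis y 1, w) = (\<integral>e. joint_cdf (eps_law s w)
    ((t * (beta0 s w + beta1 s w * d + e)) *\<^sub>R axis y 1) \<partial>e_law s w)"
proof -
  have "(\<chi> j. - ((- t *\<^sub>R axis y 1) $ j) * a) = (t * a) *\<^sub>R axis y 1" for a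
    by (simp add: vec_eq_iff axis_def)
  then show ?thesis by (simp add: p0_def)
qed

lemma support_condition_axis:
  fixes Q :: "real^'k::finite \<Rightarrow> (real \<times> (real^'j::finite)) measure"
  assumes "support_condition W Q" "w \<in> W"
  obtains d r where "0 < r"
    "\<And>x t y. \<bar>x - d\<bar> < r \<Longrightarrow> \<bar>t\<bar> < r \<Longrightarrow> (x, - t *\<^sub>R axis y 1, w) \<in> covariate_support W Q"
proof -
  obtain d U where U: "open U" "(d, 0) \<in> U" "U \<subseteq> measure_support (Q w)"
    using assms by (auto simp: support_condition_def)
  then obtain r where r: "0 < r" "ball (d, 0) r \<subseteq> U"
    by (auto elim: openE)
  show ?thesis
  \<comment> \<open>The distance to \<open>(d, 0)\<close> is at most the sum of the two deviations,
    so each gets half of the radius. The same radius serves all axes \<open>y\<close>.\<close>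
  proof (rule that[of "r / 2" d])
    fix x t y assume xt: "\<bar>x - d\<bar> < r / 2" "\<bar>t\<bar> < r / 2"
    let ?z = "- t *\<^sub>R axis y 1 :: real^'j"
    have "dist (d, 0) (x, ?z) \<le> \<bar>x - d\<bar> + \<bar>t\<bar>"
      using sqrt_sum_squares_le_sum_abs[of "dist d x" "dist 0 ?z"]
      by (simp add: dist_norm norm_Pair abs_minus_commute)
    then have "(x, ?z) \<in> ball (d, 0) r" using xt by simp
    then show "(x, ?z, w) \<in> covariate_support W Q"
      using r(2) U(3) assms(2) by (auto simp: covariate_support_def)
  qed (use r in simp)
qed

section \<open>Comparison of two observationally equivalent structures\<close>

lemma observed_structures_agree:
  fixes s s' :: "('j::finite, 'k::finite) model"
  assumes "2 \<le> \<kappa>" and "support_condition W Q" and w: "w \<in> W"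
    and s: "admissible \<kappa> W Q s" and s': "admissible \<kappa> W Q s'"
    and obs: "restrict (p0 s) (covariate_support W Q) = restrict (p0 s') (covariate_support W Q)"
  shows "beta0 s w = beta0 s' w \<and> beta1 s w = beta1 s' w"
    and "enat l \<le> \<kappa> \<Longrightarrow> moment_exists s l w \<Longrightarrow> moment_exists s' l w \<Longrightarrow> moment s l w = moment s' l w"
proof -
  let ?M = "e_law s w" and ?N = "e_law s' w"
  note M = e_law_facts[OF s w] and N = e_law_facts[OF s' w]
  interpret M: prob_space ?M by fact
  interpret N: prob_space ?N by fact
  have ne: "beta1 s w \<noteq> 0" "beta1 s' w \<noteq> 0"
    using s s' w by (auto simp: admissible_def model_on_def)
  obtain d r where "0 < r" and supp: "\<And>x t y. \<bar>x - d\<bar> < r \<Longrightarrow> \<bar>t\<bar> < r \<Longrightarrow>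
      (x, - t *\<^sub>R axis y 1, w) \<in> covariate_support W Q"
    using support_condition_axis[OF assms(2) w] by metis
  let ?F = "joint_cdf (eps_law s w)"
  \<comment> \<open>The axis is chosen for \<open>s\<close>; on it \<open>s'\<close> contributes
    only a bounded monotone function \<open>h\<close>.\<close>
  obtain y where bp: "bounded_partials \<kappa> y ?F"
    and nz: "\<And>k. enat k \<le> \<kappa> \<Longrightarrow> (partial_deriv y ^^ k) ?F 0 \<noteq> 0"
    using s w unfolding admissible_def smooth_eps_def by blast
  define c where "c k = (partial_deriv y ^^ k) ?F 0 / fact k" for k
  define g where "g t = ?F (t *\<^sub>R axis y 1)" for t
  define h where "h t = joint_cdf (eps_law s' w) (t *\<^sub>R axis y 1)" for t
  define b where "b x = beta0 s w + beta1 s w * x" for x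
  define b' where "b' x = beta0 s' w + beta1 s' w * x" for x
  have c: "c k \<noteq> 0" if "enat k \<le> \<kappa>" for k
    using nz[OF that] by (simp add: c_def)
  have g: "peano_expansion k g c" if "enat k \<le> \<kappa>" "0 < k" for k
    unfolding g_def[abs_def] c_def[abs_def] using bp that by (rule peano_expansion_along)
  have mono: "mono g" "mono h" and B: "\<bar>g x\<bar> \<le> 1" "\<bar>h x\<bar> \<le> 1" for x
    unfolding g_def[abs_def] h_def[abs_def]
    by (rule joint_cdf_ray[OF M(3,4)] joint_cdf_ray[OF N(3,4)])+
  have meas: "g \<in> borel_measurable borel" "h \<in> borel_measurable borel"
    using mono by (auto intro: borel_measurable_mono)
  have eq: "(\<integral>e. g (t * (b x + e)) \<partial>?M) = (\<integral>e. h (t * (b' x + e)) \<partial>?N)"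
    if "\<bar>x - d\<bar> < r" "\<bar>t\<bar> < r" for x t
  proof -
    have "p0 s (x, - t *\<^sub>R axis y 1, w) = p0 s' (x, - t *\<^sub>R axis y 1, w)"
      using fun_cong[OF obs, of "(x, - t *\<^sub>R axis y 1, w)"] supp[OF that]
      by (simp only: restrict_apply if_True)
    then show ?thesis unfolding p0_axis g_def h_def b_def b'_def .
  qed
  \<comment> \<open>Here the nonvanishing \<open>l\<close>-th partial derivative at 0 is used, to
    cancel \<open>c l\<close>.\<close>
  have crossed: "(\<integral>e. (b x + e) ^ l \<partial>?M) * (\<integral>e. (b' x' + e) ^ l \<partial>?N) =
      (\<integral>e. (b x' + e) ^ l \<partial>?M) * (\<integral>e. (b' x + e) ^ l \<partial>?N)"
    if "enat l \<le> \<kappa>" "0 < l" "integrable ?M (\<lambda>e. e ^ l)" "integrable ?N (\<lambda>e. e ^ l)"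
      "\<bar>x - d\<bar> < r" "\<bar>x' - d\<bar> < r" for l x x'
    using crossed_moments[OF M(1,2) that(3) N(1,2) that(4) meas B g[OF that(1,2)] that(2) \<open>0 < r\<close>
      eq[OF that(5)] eq[OF that(6)] order_refl] c[OF that(1)] by simp
  have "enat 1 \<le> \<kappa>" "enat 2 \<le> \<kappa>"
    using assms(1) by (auto simp: numeral_eq_enat one_enat_def elim: order_trans[rotated])
  have m1: "(\<integral>e. (u + e) \<partial>?M) = u" "(\<integral>e. (u + e) \<partial>?N) = u" for u
    using M N by (simp_all add: M.prob_space N.prob_space)
  \<comment> \<open>Mean zero removes the mixed term and unit variance produces the 1 that fixes the
    scale.\<close>
  have m2: "(\<integral>e. (u + e)\<^sup>2 \<partial>?M) = u\<^sup>2 + 1" "(\<integral>e. (u + e)\<^sup>2 \<partial>?N) = u\<^sup>2 + 1" for u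
    using M N by (simp_all add: power2_sum M.prob_space N.prob_space)
  show beta: "beta0 s w = beta0 s' w \<and> beta1 s w = beta1 s' w"
  proof (rule affine_index_unique[OF ne \<open>0 < r\<close>], fold b_def b'_def)
    fix x x' assume x: "\<bar>x - d\<bar> < r" "\<bar>x' - d\<bar> < r"
    show "b x * b' x' = b x' * b' x"
      using crossed[of 1, OF \<open>enat 1 \<le> \<kappa>\<close> _ _ _ x] M N by (simp add: m1)
    show "((b x)\<^sup>2 + 1) * ((b' x')\<^sup>2 + 1) = ((b x')\<^sup>2 + 1) * ((b' x)\<^sup>2 + 1)"
      using crossed[of 2, OF \<open>enat 2 \<le> \<kappa>\<close> _ _ _ x] M N by (simp add: m2)
    show "b x \<le> b x'" if "b' x \<le> b' x'"
      using index_mono[OF M(1,2,7,9) N(1,2) mono B g c \<open>0 < r\<close> eq[OF x(1)] eq[OF x(2)] that]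
        \<open>enat 1 \<le> \<kappa>\<close> by simp
  qed
  show "moment s l w = moment s' l w" if "enat l \<le> \<kappa>" "moment_exists s l w" "moment_exists s' l w"
  \<comment> \<open>Order 0 is separate because the expansion argument requires
    \<open>0 < l\<close>; both moments are then the total mass 1.\<close>
  proof (cases "l = 0")
    case True
    then show ?thesis by (simp add: M(6) N(6) M.prob_space N.prob_space)
  next
    case False
    have int: "integrable ?M (\<lambda>e. e ^ l)" "integrable ?N (\<lambda>e. e ^ l)"
      using that M(5) N(5) by auto
    have "b' = b" using beta by (simp add: b_def b'_def fun_eq_iff)
    \<comment> \<open>With \<open>\<beta>1\<close> nonzero, the interval of values of
      \<open>d\<close> yields infinitely many shifts, now common to both structures, as the
      polynomial argument requires.\<close>
    have "inj b" using ne by (simp add: inj_def b_def)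
    have "infinite {d - r<..<d + r}" using \<open>0 < r\<close> by (simp add: infinite_Ioo)
    then have "infinite (b ` {d - r<..<d + r})"
      using finite_imageD[OF _ inj_on_subset[OF \<open>inj b\<close> subset_UNIV]] by blast
    then have "(\<integral>e. e ^ l \<partial>?M) = (\<integral>e. e ^ l \<partial>?N)"
    proof (rule moment_eq_if_shifted_moments_proportional[OF M(1,2) int(1) N(1,2) int(2)])
      fix u v assume "u \<in> b ` {d - r<..<d + r}" "v \<in> b ` {d - r<..<d + r}"
      then obtain x x' where "u = b x" "v = b x'" "\<bar>x - d\<bar> < r" "\<bar>x' - d\<bar> < r"
        by (auto simp: abs_less_iff)
      then show "(\<integral>e. (u + e) ^ l \<partial>?M) * (\<integral>e. (v + e) ^ l \<partial>?N) =
          (\<integral>e. (v + e) ^ l \<partial>?M) * (\<integral>e. (u + e) ^ l \<partial>?N)"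
        using crossed[of l x x'] that(1) False int by (simp add: \<open>b' = b\<close>)
    qed
    then show ?thesis by (simp add: M(6) N(6))
  qed
qed

text \<open>\<open>restrict\<close> makes equality of observables mean agreement on the support
  only. The bound \<open>2 \<le> \<kappa>\<close> gives access to the second-order identity, through
  which unit variance fixes the scale.\<close>

theorem proposition3p1:
  fixes \<kappa> :: enat
    and W :: "(real^'k::finite) set"
    and Q :: "real^'k \<Rightarrow> (real \<times> (real^'j::finite)) measure"
  assumes "2 \<le> \<kappa>"
    and "support_condition W Q"
  defines "observed \<equiv> \<lambda>s :: ('j, 'k) model. restrict (p0 s) (covariate_support W Q)"
  shows "\<forall>w\<in>W.
    identified_from observed (admissible \<kappa> W Q) (\<lambda>s. beta0 s w) \<and>
    identified_from observed (admissible \<kappa> W Q) (\<lambda>s. beta1 s w) \<and>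
    (\<forall>l. enat l \<le> \<kappa> \<longrightarrow>
      identified_from observed (\<lambda>s. admissible \<kappa> W Q s \<and> moment_exists s l w)
        (\<lambda>s. moment s l w))"
  using observed_structures_agree[OF assms(1,2)]
  unfolding identified_from_def observed_def by blast

end
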